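(* Let $T>0$ and $k,n_1,n_2\in\mathbb{N}$. If the activation function $\rho\in C(\mathbb{R};\mathbb{R})$ is linearly activating, then the set $\mathcal{NN}^{\rho}_{k+1;n_1\times n_2}$ of single hidden layer neural networks (with input $(t,x)\in\mathbb{R}^{k+1}$, regarded as functions on $[0,T]\times\mathbb{R}^k$ by restriction) has the universal approximation property under a linear growth constraint. Moreover, the constant $\widetilde{C}_f$ in the definition of this property can be chosen to be $\widetilde{C}_f=(1+T)(1+C_f)$.
   Context: The spaces $\mathbb{R}^k$ and $\mathbb{R}^{n_1\times n_2}$ carry the Euclidean norm $|\cdot|$ (for matrices, the Euclidean norm of the entries). For a set $K$ and a function $f$, $\|f\|_{\infty,K}:=\sup_{x\in K}|f(x)|$. Universal approximation property under a linear growth constraint: a set $\mathcal{N}\subset C([0,T]\times\mathbb{R}^k;\mathbb{R}^{n_1\times n_2})$ has this property if for every $f\in C([0,T]\times\mathbb{R}^k;\mathbb{R}^{n_1\times n_2})$ for which there is a constant $C_f>0$ with $|f(t,x)|\le C_f(1+|x|)$ for all $t\in[0,T]$, $x\in\mathbb{R}^k$, there exists a constant $\widetilde{C}_f>0$ such that for every $\epsilon\in(0,1)$ and every compact set $K\subset\mathbb{R}^k$ there exists $\varphi\in\mathcal{N}$ with $\|\varphi-f\|_{\infty,[0,T]\times K}\le\epsilon$ and $|\varphi(t,x)|\le\widetilde{C}_f(1+|x|)$ for all $t\in[0,T]$, $x\in\mathbb{R}^k$ (so $\widetilde{C}_f$ does not depend on $\epsilon$ and $K$). Single hidden layer networks: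 for $\rho\in C(\mathbb{R};\mathbb{R})$, $\mathcal{NN}^{\rho}_{n_0;n_1\times n_2}$ is the set of all functions $\varphi:\mathbb{R}^{n_0}\to\mathbb{R}^{n_1\times n_2}$ of the form $\varphi(x)=\sum_{n=1}^N w_n\,\rho(a_n^\top x+b_n)$ with $N\in\mathbb{N}$, $w_n\in\mathbb{R}^{n_1\times n_2}$, $a_n\in\mathbb{R}^{n_0}$, $b_n\in\mathbb{R}$. Weighted space: let $\psi(x):=1+|x|$ for $x\in\mathbb{R}$. $\mathcal{B}_\psi(\mathbb{R};\mathbb{R})$ is the closure of the space $C^0_b(\mathbb{R};\mathbb{R})$ of bounded continuous functions with respect to the weighted norm $\|f\|_{\mathcal{B}_\psi(\mathbb{R};\mathbb{R})}:=\sup_{x\in\mathbb{R}}|f(x)|/\psi(x)$ (among functions $f:\mathbb{R}\to\mathbb{R}$ for which this is finite). Linearly activating: $\rho\in C(\mathbb{R};\mathbb{R})$ is called linearly activating if $\mathcal{NN}^{\rho}_{1;1\times1}\subseteq\mathcal{B}_\psi(\mathbb{R};\mathbb{R})$ and $\mathcal{NN}^{\rho}_{1;1\times1}$ is dense in $\mathcal{B}_\psi(\mathbb{R};\mathbb{R})$. *)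

theory Defs
  imports "HOL-Analysis.Analysis"
begin

(* Suprema of norms are taken in [0, \<infinity>]: an unbounded function then has norm
   \<infinity>, and the supremum over the empty set is 0 (over type real it would be
   unspecified in both cases). *)

definition sup_norm :: "'a set \<Rightarrow> ('a \<Rightarrow> 'b::real_normed_vector) \<Rightarrow> ennreal" where
  "sup_norm K f = (SUP x\<in>K. ennreal (norm (f x)))"

(* Elements of C([0,T] x R^k; R^{n1 x n2}) are represented by total functions that
   are continuous on this set; the definitions below never look at values outside it.
   The norm of real^'n2^'n1 is the Euclidean norm of the matrix entries. *)

definition linear_growth ::
  "real \<Rightarrow> real \<Rightarrow> (real \<times> 'a::euclidean_space \<Rightarrow> 'b::real_normed_vector) \<Rightarrow> bool" where
  "linear_growth T C f \<longleftrightarrow> (\<forall>t\<in>{0..T}. \<forall>x. norm (f (t, x)) \<le> C * (1 + norm x))"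

definition approximable_linear_growth ::
  "real \<Rightarrow> (real \<times> 'a::euclidean_space \<Rightarrow> 'b::real_normed_vector) set \<Rightarrow>
   (real \<times> 'a \<Rightarrow> 'b) \<Rightarrow> real \<Rightarrow> bool" where
  "approximable_linear_growth T N f C \<longleftrightarrow>
     (\<forall>\<epsilon>. 0 < \<epsilon> \<and> \<epsilon> < 1 \<longrightarrow> (\<forall>K. compact K \<longrightarrow>
       (\<exists>\<phi>\<in>N. sup_norm ({0..T} \<times> K) (\<lambda>p. \<phi> p - f p) \<le> ennreal \<epsilon> \<and>
              linear_growth T C \<phi>)))"

definition universal_approximation_linear_growth ::
  "real \<Rightarrow> (real \<times> 'a::euclidean_space \<Rightarrow> 'b::real_normed_vector) set \<Rightarrow> bool" where
  "universal_approximation_linear_growth T N \<longleftrightarrow>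
     (\<forall>\<phi>\<in>N. continuous_on ({0..T} \<times> UNIV) \<phi>) \<and>
     (\<forall>f. continuous_on ({0..T} \<times> UNIV) f \<longrightarrow>
       (\<exists>C>0. linear_growth T C f) \<longrightarrow>
       (\<exists>C'>0. approximable_linear_growth T N f C'))"

(* The input space R^{n0} is an arbitrary Euclidean space of dimension n0, with
   a^T x written as an inner product; the output space is real^'n2^'n1 for matrices,
   or real for 1 x 1 matrices. *)

definition neural_networks ::
  "(real \<Rightarrow> real) \<Rightarrow> ('a::euclidean_space \<Rightarrow> 'b::real_normed_vector) set" where
  "neural_networks \<rho> =
     {\<phi>. \<exists>(N::nat) (w :: nat \<Rightarrow> 'b) (a :: nat \<Rightarrow> 'a) (b :: nat \<Rightarrow> real).
        \<phi> = (\<lambda>x. \<Sum>n=1..N. \<rho> (a n \<bullet> x + b n) *\<^sub>R w n)}"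

definition weight :: "real \<Rightarrow> real" where
  "weight x = 1 + \<bar>x\<bar>"

definition weighted_norm :: "(real \<Rightarrow> real) \<Rightarrow> ennreal" where
  "weighted_norm f = (SUP x. ennreal (\<bar>f x\<bar> / weight x))"

definition weighted_space :: "(real \<Rightarrow> real) set" where
  "weighted_space =
     {f. weighted_norm f < \<infinity> \<and>
         (\<forall>\<epsilon>>0. \<exists>g\<in>bcontfun. weighted_norm (\<lambda>x. f x - g x) < ennreal \<epsilon>)}"

definition linearly_activating :: "(real \<Rightarrow> real) \<Rightarrow> bool" where
  "linearly_activating \<rho> \<longleftrightarrow>
     continuous_on UNIV \<rho> \<and>
     neural_networks \<rho> \<subseteq> weighted_space \<and>
     (\<forall>f\<in>weighted_space. \<forall>\<epsilon>>0. \<exists>\<phi>\<in>neural_networks \<rho>.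
        weighted_norm (\<lambda>x. f x - \<phi> x) < ennreal \<epsilon>)"

end

theory Submission
  imports Defs
begin

text \<open>Extend \<open>f\<close> to all times by clamping \<open>t\<close> to \<open>[0, T]\<close>, and replace every coordinate \<open>y\<close>
  of the argument by \<open>L sin (y / L)\<close>. Since \<open>\<bar>L sin (y / L)\<bar> \<le> \<bar>y\<bar>\<close>, the new function satisfies
  the same growth bound as \<open>f\<close>; for large \<open>L\<close> it is close to \<open>f\<close> on a given compact set; and it
  factors through a bounded set, on which Stone--Weierstrass provides a polynomial. So it is
  approximated uniformly on the whole space by a polynomial in the \<open>sin (y / L)\<close>, which by the
  product formula is a network with activation \<open>cos\<close>. As \<open>cos\<close> lies in the weighted space, such a
  network is within \<open>\<eta> (1 + \<bar>(t, x)\<bar>) \<le> \<eta> (1 + T) (1 + \<bar>x\<bar>)\<close> of a network with activation \<open>\<rho>\<close>.\<close>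

section \<open>Closure properties of networks\<close>

text \<open>Frees sums from the index set \<open>{1..N}\<close>: a bijection renumbers any finite
  index set, so later constructions may index the units as convenient.\<close>

lemma neural_networks_finite_sumI:
  assumes "finite I"
  shows "(\<lambda>x. \<Sum>i\<in>I. \<rho> (a i \<bullet> x + b i) *\<^sub>R w i) \<in> neural_networks \<rho>"
proof -
  obtain h where h: "bij_betw h {1..card I} I"
    using finite_same_card_bij[of "{1..card I}" I] assms by auto
  have "(\<lambda>x. \<Sum>i\<in>I. \<rho> (a i \<bullet> x + b i) *\<^sub>R w i) =
      (\<lambda>x. \<Sum>n=1..card I. \<rho> ((a \<circ> h) n \<bullet> x + (b \<circ> h) n) *\<^sub>R (w \<circ> h) n)"
    by (rule ext) (simp add: sum.reindex_bij_betw[OF h, where g = "\<lambda>i. \<rho> (a i \<bullet> x + b i) *\<^sub>R w i" for x]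
        del: atLeastAtMost_iff One_nat_def)
  then show ?thesis
    unfolding neural_networks_def by blast
qed

lemma neural_networksE:
  assumes "\<phi> \<in> neural_networks \<rho>"
  obtains N w a b where "\<phi> = (\<lambda>x. \<Sum>n=1..N::nat. \<rho> (a n \<bullet> x + b n) *\<^sub>R w n)"
  using assms unfolding neural_networks_def by blast

lemma neural_networks_unit: "(\<lambda>x. \<rho> (a \<bullet> x + b) *\<^sub>R w) \<in> neural_networks \<rho>"
  using neural_networks_finite_sumI[of "{()}" \<rho> "\<lambda>_. a" "\<lambda>_. b" "\<lambda>_. w"] by simp

lemma neural_networks_zero: "(\<lambda>x. 0) \<in> neural_networks \<rho>"
  using neural_networks_finite_sumI[of "{}" \<rho>] by simp

lemma neural_networks_add:
  assumes "\<phi> \<in> neural_networks \<rho>" "\<xi> \<in> neural_networks \<rho>"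
  shows "(\<lambda>x. \<phi> x + \<xi> x) \<in> neural_networks \<rho>"
proof -
  obtain N w a b where \<phi>: "\<phi> = (\<lambda>x. \<Sum>n=1..N::nat. \<rho> (a n \<bullet> x + b n) *\<^sub>R w n)"
    using assms(1) by (rule neural_networksE)
  obtain M v c d where \<xi>: "\<xi> = (\<lambda>x. \<Sum>n=1..M::nat. \<rho> (c n \<bullet> x + d n) *\<^sub>R v n)"
    using assms(2) by (rule neural_networksE)
  \<comment> \<open>The disjoint sum of the index sets keeps the two parameter families apart
    without shifting indices.\<close>
  have "(\<lambda>x. \<phi> x + \<xi> x) = (\<lambda>x. \<Sum>i\<in>{1..N} <+> {1..M}.
      \<rho> (case_sum a c i \<bullet> x + case_sum b d i) *\<^sub>R case_sum w v i)"
    by (simp add: \<phi> \<xi> sum.Plus)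
  then show ?thesis
    by (simp add: neural_networks_finite_sumI)
qed

lemma neural_networks_sum:
  assumes "\<And>i. i \<in> I \<Longrightarrow> \<phi> i \<in> neural_networks \<rho>"
  shows "(\<lambda>x. \<Sum>i\<in>I. \<phi> i x) \<in> neural_networks \<rho>"
  using assms
  \<comment> \<open>For infinite \<open>I\<close> the sum is 0 by convention, which is the empty
    network.\<close>
  by (induction I rule: infinite_finite_induct)
    (auto simp: neural_networks_zero intro!: neural_networks_add)

text \<open>An affine map of one variable composed with \<open>a \<bullet> x + b\<close> is again
  affine in \<open>x\<close>. This carries approximation on the real line over to several inputs and
  vector-valued outputs.\<close>

lemma neural_networks_ridge:
  assumes "h \<in> neural_networks \<rho>"
  shows "(\<lambda>x. h (a \<bullet> x + b) *\<^sub>R w) \<in> neural_networks \<rho>"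
proof -
  obtain N v c d where h: "h = (\<lambda>y::real. \<Sum>n=1..N::nat. \<rho> (c n \<bullet> y + d n) *\<^sub>R v n)"
    using assms by (rule neural_networksE)
  have "(\<lambda>x. h (a \<bullet> x + b) *\<^sub>R w) =
      (\<lambda>x. \<Sum>n=1..N. \<rho> ((c n *\<^sub>R a) \<bullet> x + (c n * b + d n)) *\<^sub>R (v n *\<^sub>R w))"
    by (simp add: h scaleR_sum_left algebra_simps)
  also have "\<dots> \<in> neural_networks \<rho>"
    by (rule neural_networks_finite_sumI) simp
  finally show ?thesis .
qed

lemma neural_networks_scaleR:
  assumes "\<phi> \<in> neural_networks \<rho>"
  shows "(\<lambda>x. \<phi> x *\<^sub>R w) \<in> neural_networks \<rho>"
proof -
  obtain N v a b where \<phi>: "\<phi> = (\<lambda>x. \<Sum>n=1..N::nat. \<rho> (a n \<bullet> x + b n) *\<^sub>R v n)"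
    using assms by (rule neural_networksE)
  have "(\<lambda>x. \<phi> x *\<^sub>R w) = (\<lambda>x. \<Sum>n=1..N. \<rho> (a n \<bullet> x + b n) *\<^sub>R (v n *\<^sub>R w))"
    by (simp add: \<phi> scaleR_sum_left)
  also have "\<dots> \<in> neural_networks \<rho>"
    by (rule neural_networks_finite_sumI) simp
  finally show ?thesis .
qed

lemma continuous_on_neural_networks:
  assumes "continuous_on UNIV \<rho>" "\<phi> \<in> neural_networks \<rho>"
  shows "continuous_on S \<phi>"
proof -
  obtain N w a b where \<phi>: "\<phi> = (\<lambda>x. \<Sum>n=1..N::nat. \<rho> (a n \<bullet> x + b n) *\<^sub>R w n)"
    using assms(2) by (rule neural_networksE)
  show ?thesis
    unfolding \<phi> by (intro continuous_intros continuous_on_compose2[OF assms(1)]) auto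
qed

section \<open>Trigonometric polynomials as networks\<close>

lemma neural_networks_cos_const: "(\<lambda>x. w) \<in> neural_networks cos"
  using neural_networks_unit[of cos 0 0 w] by simp

text \<open>The product formula turns a product of two cosines into a sum of two. With sums and
  constants, scalar cosine networks thus form an algebra, which is why \<open>cos\<close> serves as
  the intermediate activation.\<close>

lemma neural_networks_cos_mult:
  fixes \<phi> \<xi> :: "'a::euclidean_space \<Rightarrow> real"
  assumes "\<phi> \<in> neural_networks cos" "\<xi> \<in> neural_networks cos"
  shows "(\<lambda>x. \<phi> x * \<xi> x) \<in> neural_networks cos"
proof -
  obtain N w a b where \<phi>: "\<phi> = (\<lambda>x. \<Sum>n=1..N::nat. cos (a n \<bullet> x + b n) *\<^sub>R w n)"
    using assms(1) by (rule neural_networksE)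
  obtain M v c d where \<xi>: "\<xi> = (\<lambda>x. \<Sum>n=1..M::nat. cos (c n \<bullet> x + d n) *\<^sub>R v n)"
    using assms(2) by (rule neural_networksE)
  have "(cos (a n \<bullet> x + b n) *\<^sub>R w n) * (cos (c m \<bullet> x + d m) *\<^sub>R v m) =
      cos ((a n - c m) \<bullet> x + (b n - d m)) *\<^sub>R (w n * v m / 2) +
      cos ((a n + c m) \<bullet> x + (b n + d m)) *\<^sub>R (w n * v m / 2)" for n m x
    using cos_times_cos[of "a n \<bullet> x + b n" "c m \<bullet> x + d m"]
    by (simp add: inner_diff_left inner_add_left field_simps)
  then have "(\<lambda>x. \<phi> x * \<xi> x) = (\<lambda>x. \<Sum>n=1..N. \<Sum>m=1..M.
      cos ((a n - c m) \<bullet> x + (b n - d m)) *\<^sub>R (w n * v m / 2) +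
      cos ((a n + c m) \<bullet> x + (b n + d m)) *\<^sub>R (w n * v m / 2))"
    by (simp only: \<phi> \<xi> sum_product)
  also have "\<dots> \<in> neural_networks cos"
    by (intro neural_networks_sum neural_networks_add neural_networks_unit)
  finally show ?thesis .
qed

text \<open>The outer factor \<open>L\<close> gives slope 1 at the origin, so the map tends to the
  identity as \<open>L\<close> grows, yet its range is bounded for each \<open>L\<close>.\<close>

definition sine_map :: "real \<Rightarrow> 'a::euclidean_space \<Rightarrow> 'a" where
  "sine_map L x = (\<Sum>i\<in>Basis. (L * sin ((x \<bullet> i) / L)) *\<^sub>R i)"

lemma sine_map_inner: "i \<in> Basis \<Longrightarrow> sine_map L x \<bullet> i = L * sin ((x \<bullet> i) / L)"
  by (simp add: sine_map_def)

lemma neural_networks_cos_polynomial_sine_map: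
  fixes p :: "'a::euclidean_space \<Rightarrow> real"
  assumes "real_polynomial_function p"
  shows "(\<lambda>x. p (sine_map L x)) \<in> neural_networks cos"
  using assms
proof (induction rule: real_polynomial_function.induct)
  case (linear f)
  interpret f: bounded_linear f by fact
  \<comment> \<open>A sine is a cosine with phase shifted by \<open>pi / 2\<close>. For
    \<open>L = 0\<close> both sides vanish, division by zero being 0.\<close>
  have *: "cos ((i /\<^sub>R L) \<bullet> x + (- (pi / 2))) = sin ((x \<bullet> i) / L)" for i x
    by (simp only: cos_add) (simp add: inner_commute[of i x] divide_inverse_commute[of "x \<bullet> i"])
  have "(\<lambda>x. f (sine_map L x)) =
      (\<lambda>x. \<Sum>i\<in>Basis. cos ((i /\<^sub>R L) \<bullet> x + (- (pi / 2))) *\<^sub>R (L * f i))"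
    unfolding sine_map_def f.sum f.scaleR * by (simp add: mult_ac)
  also have "\<dots> \<in> neural_networks cos"
    by (intro neural_networks_sum neural_networks_unit)
  finally show ?case .
next
  case (const c)
  show ?case by (rule neural_networks_cos_const)
next
  case (add f g)
  then show ?case by (intro neural_networks_add)
next
  case (mult f g)
  then show ?case by (intro neural_networks_cos_mult)
qed

lemma neural_networks_cos_polynomial_function_sine_map:
  fixes p :: "'a::euclidean_space \<Rightarrow> 'b::euclidean_space"
  assumes "polynomial_function p"
  shows "(\<lambda>x. p (sine_map L x)) \<in> neural_networks cos"
proof -
  have "real_polynomial_function (\<lambda>x. p x \<bullet> i)" if "i \<in> Basis" for i
    using assms that polynomial_function_iff_Basis_inner by blast
  then have "(\<lambda>x. \<Sum>i\<in>Basis. (p (sine_map L x) \<bullet> i) *\<^sub>R i) \<in> neural_networks cos"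
    by (intro neural_networks_sum neural_networks_scaleR)
      (rule neural_networks_cos_polynomial_sine_map)
  then show ?thesis
    by (simp add: euclidean_representation)
qed

section \<open>Size and displacement estimates for the sine map\<close>

lemma abs_sine_scaled_le:
  fixes L y :: real
  assumes "L > 0"
  shows "\<bar>L * sin (y / L)\<bar> \<le> \<bar>y\<bar>"
proof -
  have "L * \<bar>sin (y / L)\<bar> \<le> L * \<bar>y / L\<bar>"
    using assms abs_sin_x_le_abs_x[of "y / L"] by (intro mult_left_mono) auto
  then show ?thesis
    using assms by (simp add: abs_mult)
qed

lemma sine_scaled_diff_le:
  fixes L y :: real
  assumes "L > 0"
  shows "\<bar>L * sin (y / L) - y\<bar> \<le> y\<^sup>2 / L"
proof -
  \<comment> \<open>Taylor remainder of order two at 0, with its factor 1/2 dropped.\<close>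
  have "\<bar>sin (y / L) - y / L\<bar> \<le> (y / L)\<^sup>2"
    using Maclaurin_sin_bound[of "y / L" 2]
    by (simp add: sin_coeff_def eval_nat_numeral)
  then have "L * \<bar>sin (y / L) - y / L\<bar> \<le> L * (y / L)\<^sup>2"
    using assms by (intro mult_left_mono) auto
  also have "L * \<bar>sin (y / L) - y / L\<bar> = \<bar>L * (sin (y / L) - y / L)\<bar>"
    using assms by (simp add: abs_mult)
  also have "L * (sin (y / L) - y / L) = L * sin (y / L) - y"
    using assms by (simp add: field_simps)
  also have "L * (y / L)\<^sup>2 = y\<^sup>2 / L"
    using assms by (simp add: power2_eq_square)
  finally show ?thesis .
qed

lemma norm_sine_map_le: "L > 0 \<Longrightarrow> norm (sine_map L x) \<le> norm x"
  by (rule norm_le_componentwise) (simp add: sine_map_inner abs_sine_scaled_le)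

text \<open>The growth bound on \<open>f\<close> involves only the space variable, so the norm bound
  is wanted for the second component alone. It survives the projection because the map acts
  coordinatewise.\<close>

lemma norm_snd_sine_map_le:
  fixes p :: "'a::euclidean_space \<times> 'b::euclidean_space"
  assumes "L > 0"
  shows "norm (snd (sine_map L p)) \<le> norm (snd p)"
proof (rule norm_le_componentwise)
  fix i :: 'b assume i: "i \<in> Basis"
  then have "(0, i) \<in> (Basis :: ('a \<times> 'b) set)"
    by (simp add: Basis_prod_def)
  moreover have "snd q \<bullet> i = q \<bullet> (0, i)" for q :: "'a \<times> 'b"
    by (cases q) simp
  ultimately show "\<bar>snd (sine_map L p) \<bullet> i\<bar> \<le> \<bar>snd p \<bullet> i\<bar>"
    using assms by (simp add: sine_map_inner abs_sine_scaled_le)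
qed

text \<open>Supplies the ball, depending only on \<open>L\<close>, on which Stone-Weierstrass is
  applied.\<close>

lemma norm_sine_map_bound:
  fixes x :: "'a::euclidean_space"
  assumes "L > 0"
  shows "norm (sine_map L x) \<le> real DIM('a) * L"
proof -
  have "norm (sine_map L x) \<le> (\<Sum>i\<in>Basis. \<bar>sine_map L x \<bullet> i\<bar>)"
    by (rule norm_le_l1)
  also have "\<dots> \<le> (\<Sum>i\<in>(Basis::'a set). L)"
    using assms by (intro sum_mono) (simp add: sine_map_inner abs_mult mult_left_le)
  finally show ?thesis by simp
qed

lemma norm_sine_map_diff_le:
  fixes x :: "'a::euclidean_space"
  assumes "L > 0"
  shows "norm (sine_map L x - x) \<le> DIM('a) * (norm x)\<^sup>2 / L"
proof -
  have "norm (sine_map L x - x) \<le> (\<Sum>i\<in>Basis. \<bar>(sine_map L x - x) \<bullet> i\<bar>)"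
    by (rule norm_le_l1)
  also have "\<dots> \<le> (\<Sum>i\<in>(Basis::'a set). (norm x)\<^sup>2 / L)"
  proof (rule sum_mono)
    fix i :: 'a assume i: "i \<in> Basis"
    then have "\<bar>(sine_map L x - x) \<bullet> i\<bar> \<le> (x \<bullet> i)\<^sup>2 / L"
      using sine_scaled_diff_le[OF assms] by (simp add: inner_diff_left sine_map_inner)
    also have "\<dots> \<le> (norm x)\<^sup>2 / L"
      using assms Basis_le_norm[OF i, of x]
      by (intro divide_right_mono) (auto simp: abs_le_square_iff[symmetric])
    finally show "\<bar>(sine_map L x - x) \<bullet> i\<bar> \<le> (norm x)\<^sup>2 / L" .
  qed
  finally show ?thesis by simp
qed

section \<open>Approximation through the sine map\<close>

lemma sine_map_approximates:
  fixes F :: "'a::euclidean_space \<Rightarrow> 'b::metric_space"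
  assumes "continuous_on UNIV F" "e > 0"
  obtains L where "L > 0" "\<And>x. norm x \<le> R \<Longrightarrow> dist (F (sine_map L x)) (F x) < e"
proof -
  \<comment> \<open>The sine map sends this ball into itself, so a single modulus of continuity on
    it is enough.\<close>
  have "uniformly_continuous_on (cball 0 R) F"
    by (rule compact_uniformly_continuous) (use assms(1) continuous_on_subset in auto)
  then obtain d where d: "d > 0"
    "\<And>x y. x \<in> cball 0 R \<Longrightarrow> y \<in> cball 0 R \<Longrightarrow> dist y x < d \<Longrightarrow> dist (F y) (F x) < e"
    using assms(2) by (rule uniformly_continuous_onE) (rule that)
  \<comment> \<open>Makes the displacement bound \<open>DIM('a) * R\<^sup>2 / L\<close> smaller than
    \<open>d\<close>; the summand 1 gives strictness, and positivity even for
    \<open>R = 0\<close>.\<close>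
  define L where "L = DIM('a) * R\<^sup>2 / d + 1"
  have L: "L > 0"
    using d(1) by (simp add: L_def add_nonneg_pos)
  have "dist (F (sine_map L x)) (F x) < e" if x: "norm x \<le> R" for x
  proof (rule d(2))
    show "x \<in> cball 0 R" "sine_map L x \<in> cball 0 R"
      using x norm_sine_map_le[OF L, of x] by auto
    have "norm (sine_map L x - x) \<le> DIM('a) * (norm x)\<^sup>2 / L"
      by (rule norm_sine_map_diff_le[OF L])
    also have "\<dots> \<le> DIM('a) * R\<^sup>2 / L"
      using x L by (intro divide_right_mono mult_left_mono power_mono) auto
    also have "\<dots> < d"
    proof -
      have "DIM('a) * R\<^sup>2 < d * L"
        using d(1) by (simp add: L_def distrib_left)
      then show ?thesis
        using L by (simp add: divide_less_eq)
    qed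
    finally show "dist (sine_map L x) x < d"
      by (simp add: dist_norm)
  qed
  with L show ?thesis using that by blast
qed

text \<open>The error is uniform on the whole space because every argument of \<open>F\<close> and
  of the polynomial lies in one fixed ball.\<close>

lemma sine_map_uniform_approximation:
  fixes F :: "'a::euclidean_space \<Rightarrow> 'b::euclidean_space"
  assumes "continuous_on UNIV F" "e > 0" "L > 0"
  obtains \<phi> where "\<phi> \<in> neural_networks cos" "\<And>x. norm (F (sine_map L x) - \<phi> x) < e"
proof -
  have "\<exists>p. polynomial_function p \<and> (\<forall>x\<in>cball 0 (real DIM('a) * L). norm (F x - p x) < e)"
    using assms by (intro Stone_Weierstrass_polynomial_function continuous_on_subset[OF assms(1)]) auto
  then obtain p where p: "polynomial_function p"
    "\<And>x. x \<in> cball 0 (real DIM('a) * L) \<Longrightarrow> norm (F x - p x) < e"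
    by auto
  show ?thesis
  proof
    show "(\<lambda>x. p (sine_map L x)) \<in> neural_networks cos"
      by (rule neural_networks_cos_polynomial_function_sine_map[OF p(1)])
    show "norm (F (sine_map L x) - p (sine_map L x)) < e" for x
      using norm_sine_map_bound[OF assms(3), of x] by (intro p(2)) simp
  qed
qed

section \<open>Linearly activating functions\<close>

lemma weighted_norm_leI:
  assumes "\<And>x. \<bar>f x\<bar> \<le> c * weight x"
  shows "weighted_norm f \<le> ennreal c"
  unfolding weighted_norm_def
proof (rule SUP_least, rule ennreal_leI)
  show "\<bar>f x\<bar> / weight x \<le> c" for x
    using assms[of x] by (simp add: weight_def divide_le_eq)
qed

lemma weighted_norm_lessD:
  assumes "weighted_norm f < ennreal e"
  shows "\<bar>f x\<bar> \<le> e * weight x"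
proof -
  have "ennreal (\<bar>f x\<bar> / weight x) \<le> weighted_norm f"
    unfolding weighted_norm_def by (rule SUP_upper) simp
  then have "\<bar>f x\<bar> / weight x < e"
    using assms by (auto simp: weight_def ennreal_less_iff dest: order.strict_trans1)
  moreover have "weight x > 0"
    by (simp add: weight_def add_pos_nonneg)
  ultimately show ?thesis by (simp add: pos_divide_less_eq)
qed

text \<open>Being bounded and continuous, \<open>cos\<close> is its own approximant; membership
  makes the density assumption applicable to it.\<close>

lemma cos_in_weighted_space: "(cos :: real \<Rightarrow> real) \<in> weighted_space"
proof -
  have "cos \<in> (bcontfun :: (real \<Rightarrow> real) set)"
    by (rule bcontfun_normI[of _ 1]) (auto intro: continuous_intros)
  moreover have "weighted_norm (\<lambda>x. cos x - cos x) < ennreal e" if "e > 0" for e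
    using weighted_norm_leI[of "\<lambda>x. cos x - cos x" 0] that
    by (simp add: ennreal_less_zero_iff)
  moreover have "weighted_norm cos \<le> ennreal 1"
    by (rule weighted_norm_leI) (simp add: weight_def add_increasing2)
  then have "weighted_norm cos < \<infinity>"
    by (simp add: order.strict_trans1)
  ultimately show ?thesis
    unfolding weighted_space_def by blast
qed

lemma linearly_activating_approximates_cos_unit:
  fixes a :: "'a::euclidean_space" and w :: "'b::real_normed_vector"
  assumes "linearly_activating \<rho>" "e > 0"
  obtains \<phi> where "\<phi> \<in> neural_networks \<rho>"
    "\<And>x. norm (cos (a \<bullet> x + b) *\<^sub>R w - \<phi> x) \<le> e * (1 + norm x)"
proof -
  \<comment> \<open>Collects the two losses: \<open>weight (a \<bullet> x + b)\<close> against
    \<open>1 + norm x\<close>, and the output weight \<open>w\<close>. Using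
    \<open>1 + norm w\<close> keeps \<open>M\<close> positive when \<open>w = 0\<close>.\<close>
  define M where "M = (1 + \<bar>b\<bar> + norm a) * (1 + norm w)"
  have M: "M > 0"
    unfolding M_def by (intro mult_pos_pos add_pos_nonneg) auto
  then obtain h where h: "h \<in> neural_networks \<rho>" "weighted_norm (\<lambda>y. cos y - h y) < ennreal (e / M)"
    using assms cos_in_weighted_space unfolding linearly_activating_def
    by (meson divide_pos_pos)
  show ?thesis
  proof
    show "(\<lambda>x. h (a \<bullet> x + b) *\<^sub>R w) \<in> neural_networks \<rho>"
      by (rule neural_networks_ridge[OF h(1)])
    fix x
    let ?y = "a \<bullet> x + b"
    have "weight ?y \<le> 1 + \<bar>b\<bar> + norm a * norm x"
      using Cauchy_Schwarz_ineq2[of a x] by (simp add: weight_def)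
    also have "\<dots> \<le> (1 + \<bar>b\<bar> + norm a) * (1 + norm x)"
      by (simp add: algebra_simps)
    finally have y: "weight ?y \<le> (1 + \<bar>b\<bar> + norm a) * (1 + norm x)" .
    have "norm (cos ?y *\<^sub>R w - h ?y *\<^sub>R w) = \<bar>cos ?y - h ?y\<bar> * norm w"
      by (simp flip: scaleR_diff_left)
    also have "\<dots> \<le> (e / M * weight ?y) * (1 + norm w)"
      using weighted_norm_lessD[OF h(2), of ?y] assms(2) M
      by (intro mult_mono) (auto simp: weight_def)
    also have "\<dots> \<le> (e / M * ((1 + \<bar>b\<bar> + norm a) * (1 + norm x))) * (1 + norm w)"
      using y assms(2) M by (intro mult_right_mono mult_left_mono) auto
    also have "\<dots> = e / M * (M * (1 + norm x))"
      by (simp add: M_def mult_ac)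
    also have "\<dots> = e * (1 + norm x)"
      using M by simp
    finally show "norm (cos ?y *\<^sub>R w - h ?y *\<^sub>R w) \<le> e * (1 + norm x)" .
  qed
qed

lemma linearly_activating_approximates_cos_network:
  fixes \<xi> :: "'a::euclidean_space \<Rightarrow> 'b::real_normed_vector"
  assumes "linearly_activating \<rho>" "e > 0" "\<xi> \<in> neural_networks cos"
  obtains \<phi> where "\<phi> \<in> neural_networks \<rho>" "\<And>x. norm (\<xi> x - \<phi> x) \<le> e * (1 + norm x)"
proof -
  obtain N w a b where \<xi>: "\<xi> = (\<lambda>x. \<Sum>n=1..N::nat. cos (a n \<bullet> x + b n) *\<^sub>R w n)"
    using assms(3) by (rule neural_networksE)
  \<comment> \<open>The error is shared among the \<open>N\<close> units; \<open>N + 1\<close>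
    avoids division by zero for the empty network.\<close>
  define d where "d = e / (real N + 1)"
  have d: "d > 0" using assms(2) by (simp add: d_def)
  have "\<exists>\<phi>\<in>neural_networks \<rho>. \<forall>x. norm (cos (a n \<bullet> x + b n) *\<^sub>R w n - \<phi> x) \<le> d * (1 + norm x)" for n
    using linearly_activating_approximates_cos_unit[OF assms(1) d] by metis
  then obtain \<phi> where \<phi>: "\<And>n. \<phi> n \<in> neural_networks \<rho>"
    "\<And>n x. norm (cos (a n \<bullet> x + b n) *\<^sub>R w n - \<phi> n x) \<le> d * (1 + norm x)"
    by metis
  show ?thesis
  proof
    show "(\<lambda>x. \<Sum>n=1..N. \<phi> n x) \<in> neural_networks \<rho>"
      by (intro neural_networks_sum \<phi>(1))
    fix x
    have "norm (\<xi> x - (\<Sum>n=1..N. \<phi> n x)) \<le> (\<Sum>n=1..N. d * (1 + norm x))"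
      unfolding \<xi> sum_subtractf[symmetric] by (rule sum_norm_le) (rule \<phi>(2))
    also have "\<dots> = (real N * d) * (1 + norm x)"
      by simp
    also have "\<dots> \<le> e * (1 + norm x)"
      using assms(2) by (intro mult_right_mono) (auto simp: d_def field_simps)
    finally show "norm (\<xi> x - (\<Sum>n=1..N. \<phi> n x)) \<le> e * (1 + norm x)" .
  qed
qed

section \<open>Universal approximation\<close>

lemma linearly_activating_approximable:
  fixes f :: "real \<times> 'a::euclidean_space \<Rightarrow> 'b::euclidean_space"
  assumes T: "T > 0" and act: "linearly_activating \<rho>"
    and cont: "continuous_on ({0..T} \<times> UNIV) f"
    and C: "C > 0" and growth: "linear_growth T C f"
  shows "approximable_linear_growth T (neural_networks \<rho>) f ((1 + T) * (1 + C))"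
  unfolding approximable_linear_growth_def
proof (intro allI impI)
  fix e :: real and K :: "'a set"
  assume e: "0 < e \<and> e < 1" and K: "compact K"
  \<comment> \<open>The sine map moves the time coordinate too and may push it out of
    \<open>[0, T]\<close>. Clamping makes \<open>F\<close> continuous everywhere and keeps the
    growth bound of \<open>f\<close> at all times.\<close>
  define F where "F p = f (max 0 (min T (fst p)), snd p)" for p
  have F_cont: "continuous_on UNIV F"
    unfolding F_def using T
    by (intro continuous_on_compose2[OF cont] continuous_intros) auto
  have F_eq: "F p = f p" if "fst p \<in> {0..T}" for p
    using that by (cases p) (simp add: F_def max_absorb2 min_absorb2)
  have F_growth: "norm (F p) \<le> C * (1 + norm (snd p))" for p
    using growth T by (simp add: F_def linear_growth_def)
  have "bounded ({0..T} \<times> K)"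
    using K by (intro bounded_Times compact_imp_bounded) auto
  then obtain R where R: "R > 0" "\<And>p. p \<in> {0..T} \<times> K \<Longrightarrow> norm p \<le> R"
    unfolding bounded_pos by blast
  obtain L where L: "L > 0" "\<And>p. norm p \<le> R \<Longrightarrow> dist (F (sine_map L p)) (F p) < e / 3"
    using sine_map_approximates[OF F_cont, of "e / 3" R] e by auto
  obtain \<xi> where \<xi>: "\<xi> \<in> neural_networks cos" "\<And>p. norm (F (sine_map L p) - \<xi> p) < e / 3"
    using sine_map_uniform_approximation[OF F_cont _ L(1), of "e / 3"] e by auto
  \<comment> \<open>Serves two purposes: on \<open>{0..T} \<times> K\<close> the weighted error is
    at most \<open>e / 3\<close>, and elsewhere \<open>d \<le> 1 / 3\<close>, from
    \<open>e < 1\<close> and \<open>R > 0\<close>, bounds the growth independently of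
    \<open>e\<close> and \<open>K\<close>.\<close>
  define d where "d = e / (3 * (1 + R))"
  have d: "d > 0" "d * (1 + R) = e / 3" "d \<le> 1 / 3"
    using e R(1) by (auto simp: d_def field_simps)
  obtain \<phi> where \<phi>: "\<phi> \<in> neural_networks \<rho>" "\<And>p. norm (\<xi> p - \<phi> p) \<le> d * (1 + norm p)"
    using linearly_activating_approximates_cos_network[OF act d(1) \<xi>(1)] by blast
  have "norm (\<phi> p - f p) \<le> e" if p: "p \<in> {0..T} \<times> K" for p
  proof -
    have "d * (1 + norm p) \<le> d * (1 + R)"
      using R(2)[OF p] d(1) by (intro mult_left_mono) auto
    then have "norm (\<xi> p - \<phi> p) \<le> e / 3"
      using \<phi>(2)[of p] d(2) by linarith
    moreover have "norm (F (sine_map L p) - f p) < e / 3"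
      using L(2)[OF R(2)[OF p]] F_eq[of p] p by (auto simp: dist_norm)
    \<comment> \<open>The nested difference telescopes to \<open>\<phi> p - f p\<close>, with each
      of the three errors at most \<open>e / 3\<close>.\<close>
    ultimately have "norm ((F (sine_map L p) - f p) - (F (sine_map L p) - \<xi> p) - (\<xi> p - \<phi> p)) \<le> e"
      using \<xi>(2)[of p] norm_triangle_ineq4[of "F (sine_map L p) - f p" "F (sine_map L p) - \<xi> p"]
        norm_triangle_ineq4[of "(F (sine_map L p) - f p) - (F (sine_map L p) - \<xi> p)" "\<xi> p - \<phi> p"]
      by linarith
    then show ?thesis by simp
  qed
  then have "sup_norm ({0..T} \<times> K) (\<lambda>p. \<phi> p - f p) \<le> ennreal e"
    unfolding sup_norm_def by (intro SUP_least ennreal_leI)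
  moreover have "linear_growth T ((1 + T) * (1 + C)) \<phi>"
    unfolding linear_growth_def
  proof (intro ballI allI)
    fix t and x :: 'a assume t: "t \<in> {0..T}"
    let ?p = "(t, x)"
    have "norm ?p \<le> T + norm x"
      using norm_Pair_le[of t x] t by simp
    then have "d * (1 + norm ?p) \<le> 1 / 3 * (1 + (T + norm x))"
      using d T by (intro mult_mono) auto
    moreover have "C * (1 + norm (snd (sine_map L ?p))) \<le> C * (1 + norm x)"
      using norm_snd_sine_map_le[OF L(1), of ?p] C by (intro mult_left_mono) auto
    then have "norm (F (sine_map L ?p)) \<le> C * (1 + norm x)"
      using F_growth[of "sine_map L ?p"] by linarith
    moreover have "norm (\<phi> ?p) \<le>
        norm (F (sine_map L ?p)) + norm (F (sine_map L ?p) - \<xi> ?p) + norm (\<xi> ?p - \<phi> ?p)"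
      using norm_triangle_ineq4[of "F (sine_map L ?p)" "F (sine_map L ?p) - \<xi> ?p"]
        norm_triangle_ineq4[of "\<xi> ?p" "\<xi> ?p - \<phi> ?p"] by simp
    \<comment> \<open>The terms come from \<open>F\<close> after the sine map, the uniform error
      below \<open>e / 3 < 1 / 3\<close>, and the weighted error with \<open>d \<le> 1 / 3\<close>.
      Neither \<open>e\<close> nor \<open>K\<close> remains.\<close>
    ultimately have "norm (\<phi> ?p) \<le> C * (1 + norm x) + 1 / 3 + 1 / 3 * (1 + (T + norm x))"
      using \<xi>(2)[of ?p] \<phi>(2)[of ?p] e by linarith
    also have "\<dots> \<le> C * (1 + norm x) + (1 + T + norm x)"
      using T norm_ge_zero[of x] by argo
    also have "\<dots> \<le> (1 + T) * (1 + C) * (1 + norm x)"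
      using T C by (simp add: algebra_simps)
    finally show "norm (\<phi> ?p) \<le> (1 + T) * (1 + C) * (1 + norm x)" .
  qed
  ultimately show "\<exists>\<phi>\<in>neural_networks \<rho>.
      sup_norm ({0..T} \<times> K) (\<lambda>p. \<phi> p - f p) \<le> ennreal e \<and>
      linear_growth T ((1 + T) * (1 + C)) \<phi>"
    using \<phi>(1) by blast
qed

theorem theorem2p3:
  fixes T :: real and \<rho> :: "real \<Rightarrow> real"
  assumes "T > 0"
    and "continuous_on UNIV \<rho>"
    and "linearly_activating \<rho>"
  shows "universal_approximation_linear_growth T
      (neural_networks \<rho> :: (real \<times> (real ^ 'k) \<Rightarrow> real ^ 'n2 ^ 'n1) set) \<and>
    (\<forall>(f :: real \<times> (real ^ 'k) \<Rightarrow> real ^ 'n2 ^ 'n1) C.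
       continuous_on ({0..T} \<times> UNIV) f \<longrightarrow> C > 0 \<longrightarrow> linear_growth T C f \<longrightarrow>
       approximable_linear_growth T (neural_networks \<rho>) f ((1 + T) * (1 + C)))"
proof -
  have "(1 + T) * (1 + C) > 0" if "C > 0" for C
    using assms(1) that by (intro mult_pos_pos) auto
  then show ?thesis
    unfolding universal_approximation_linear_growth_def
    using linearly_activating_approximable[OF assms(1,3)] continuous_on_neural_networks[OF assms(2)]
    by blast
qed

end
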